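(* Let $M$ and $N$ be two weighted means defined on the intervals $[u,v]\subseteq(0,\infty)$ and $J\subseteq(0,\infty)$ respectively (with the same direction). If $f:[u,v]\to J$ is $MN$-convex and symmetric with respect to $M(u,v,1/2)$, then $$f\big(M(u,v,1/2)\big)\le f(x)\le N\big(f(u),f(v),1/2\big)$$ for all $x\in[u,v]$.
   Context: A function $M:(0,\infty)\times(0,\infty)\times[0,1]\to(0,\infty)$ is called a weighted mean (function) if the following hold. (WM1) $M(u,v,\lambda)=M(v,u,1-\lambda)$. (WM2) $M(u,u,\lambda)=u$. (WM3) $u<M(u,v,\lambda)<v$ whenever $u<v$ and $\lambda\in(0,1)$. (WM4) $M(\alpha u,\alpha v,\lambda)=\alpha M(u,v,\lambda)$ for all $\alpha>0$. (WM5) For fixed $\lambda\in[0,1]$: $M(u,v,\lambda)\le M(w,v,\lambda)$ whenever $u\le w$, and $M(u,v,\lambda)\le M(u,\omega,\lambda)$ whenever $v\le\omega$. (WM6) For fixed $u,v\in(0,\infty)$ with $u\ne v$, $M(u,v,\cdot)$ is a strictly monotone and continuous function on $[0,1]$. (WM7) $M(M(u,v,\lambda),M(z,w,\lambda),s)=M(M(u,z,s),M(v,w,s),\lambda)$ for all $u,v,z,w\in(0,\infty)$ and $s,\lambda\in[0,1]$. (WM8) $M(u,v,s\lambda_1+(1-s)\lambda_2)=M(M(u,v,\lambda_1),M(u,v,\lambda_2),s)$ for all $u,v\in(0,\infty)$ and $s,\lambda_1,\lambda_2\in[0,1]$. The paper remarks (as a consequence of (WM6), not as an axiom) that each $x\in[u,v]\subseteq(0,\infty)$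 equals $M(u,v,\lambda)$ for some $\lambda\in[0,1]$, and that for $u<v$: if $M(u,v,\cdot)$ is strictly increasing then $M(u,v,0)=u$, $M(u,v,1)=v$ ("positive direction"); if it is strictly decreasing then $M(u,v,0)=v$, $M(u,v,1)=u$ ("negative direction"). Different weighted means are assumed to have the same direction. For weighted means $M,N$ defined on intervals $I,J\subseteq(0,\infty)$ respectively, a function $f:I\to J$ is $MN$-convex if $f(M(a,b,\lambda))\le N(f(a),f(b),\lambda)$ for all $a,b\in I$ and $\lambda\in[0,1]$. A function $f:[u,v]\to J$ is symmetric with respect to $M(u,v,1/2)$ if $f(M(u,v,\lambda))=f(M(u,v,1-\lambda))$ for all $\lambda\in[0,1]$. *)

theory Defs
  imports "HOL-Analysis.Analysis"
begin

text \<open>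
  A weighted mean is a function on \<open>(0,\<infinity>) \<times> (0,\<infinity>) \<times> [0,1]\<close> with values in \<open>(0,\<infinity>)\<close>.
  It is encoded as a total function whose values outside this domain are irrelevant.
  The values at \<open>l = 0\<close> and \<open>l = 1\<close> are deliberately not prescribed: that they are the two
  arguments is a consequence of the axioms.
\<close>

definition weighted_mean :: "(real \<Rightarrow> real \<Rightarrow> real \<Rightarrow> real) \<Rightarrow> bool" where
  "weighted_mean M \<longleftrightarrow>
     (\<forall>u>0. \<forall>v>0. \<forall>l\<in>{0..1}. M u v l > 0) \<and>
     (\<forall>u>0. \<forall>v>0. \<forall>l\<in>{0..1}. M u v l = M v u (1 - l)) \<and>
     (\<forall>u>0. \<forall>l\<in>{0..1}. M u u l = u) \<and>
     (\<forall>u>0. \<forall>v>0. \<forall>l\<in>{0<..<1}. u < v \<longrightarrow> u < M u v l \<and> M u v l < v) \<and>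
     (\<forall>u>0. \<forall>v>0. \<forall>l\<in>{0..1}. \<forall>c>0. M (c * u) (c * v) l = c * M u v l) \<and>
     (\<forall>l\<in>{0..1}.
        (\<forall>u>0. \<forall>w>0. \<forall>v>0. u \<le> w \<longrightarrow> M u v l \<le> M w v l) \<and>
        (\<forall>u>0. \<forall>v>0. \<forall>w>0. v \<le> w \<longrightarrow> M u v l \<le> M u w l)) \<and>
     (\<forall>u>0. \<forall>v>0. u \<noteq> v \<longrightarrow>
        (strict_mono_on {0..1} (M u v) \<or> strict_antimono_on {0..1} (M u v)) \<and>
        continuous_on {0..1} (M u v)) \<and>
     (\<forall>u>0. \<forall>v>0. \<forall>z>0. \<forall>w>0. \<forall>s\<in>{0..1}. \<forall>l\<in>{0..1}.
        M (M u v l) (M z w l) s = M (M u z s) (M v w s) l) \<and>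
     (\<forall>u>0. \<forall>v>0. \<forall>s\<in>{0..1}. \<forall>l\<^sub>1\<in>{0..1}. \<forall>l\<^sub>2\<in>{0..1}.
        M u v (s * l\<^sub>1 + (1 - s) * l\<^sub>2) = M (M u v l\<^sub>1) (M u v l\<^sub>2) s)"

definition positive_direction :: "(real \<Rightarrow> real \<Rightarrow> real \<Rightarrow> real) \<Rightarrow> bool" where
  "positive_direction M \<longleftrightarrow> (\<forall>u>0. \<forall>v>u. strict_mono_on {0..1} (M u v))"

definition negative_direction :: "(real \<Rightarrow> real \<Rightarrow> real \<Rightarrow> real) \<Rightarrow> bool" where
  "negative_direction M \<longleftrightarrow> (\<forall>u>0. \<forall>v>u. strict_antimono_on {0..1} (M u v))"

definition same_direction ::
    "(real \<Rightarrow> real \<Rightarrow> real \<Rightarrow> real) \<Rightarrow> (real \<Rightarrow> real \<Rightarrow> real \<Rightarrow> real) \<Rightarrow> bool" where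
  "same_direction M N \<longleftrightarrow>
     positive_direction M \<and> positive_direction N \<or>
     negative_direction M \<and> negative_direction N"

text \<open>
  Means on an interval are restrictions of weighted means on \<open>(0,\<infinity>)\<close>, so the interval enters
  only as the domain \<open>I\<close> of \<open>f\<close>; that \<open>f\<close> maps \<open>I\<close> into the interval of \<open>N\<close> is assumed separately.
\<close>

definition MN_convex_on ::
    "real set \<Rightarrow> (real \<Rightarrow> real \<Rightarrow> real \<Rightarrow> real) \<Rightarrow> (real \<Rightarrow> real \<Rightarrow> real \<Rightarrow> real) \<Rightarrow>
     (real \<Rightarrow> real) \<Rightarrow> bool" where
  "MN_convex_on I M N f \<longleftrightarrow>
     (\<forall>a\<in>I. \<forall>b\<in>I. \<forall>l\<in>{0..1}. f (M a b l) \<le> N (f a) (f b) l)"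

text \<open>Symmetry of \<open>f\<close> on \<open>[u,v]\<close> with respect to the midpoint \<open>M u v (1/2)\<close>:\<close>

definition mean_symmetric_on ::
    "real \<Rightarrow> real \<Rightarrow> (real \<Rightarrow> real \<Rightarrow> real \<Rightarrow> real) \<Rightarrow> (real \<Rightarrow> real) \<Rightarrow> bool" where
  "mean_symmetric_on u v M f \<longleftrightarrow> (\<forall>l\<in>{0..1}. f (M u v l) = f (M u v (1 - l)))"

end

(* The crux is that a weighted mean satisfies M(p,q,1) = p.  By (WM8) with s = 1, this holds for all
   p, q in the range of M(1,2,.), a nondegenerate interval, hence by homogeneity whenever p/q is
   close enough to 1.  By (WM7) the map T(x) = M(p,x,1/2) commutes with M(p,.,1), and it moves every
   x \<noteq> p strictly towards p without reaching p.  As T is continuous, its iterates carry any q into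
   the range of ratios already settled, so M(p,q,1) = p for all p, q.
   Then [u,v] is the range of M(u,v,.), symmetry gives f(u) = f(v), and both inequalities are
   instances of convexity between points where f takes equal values. *)
theory Submission
  imports Defs
begin

text \<open>Off \<open>U\<close>, the decrease of the distance to \<open>p\<close> is continuous and
  positive on the compact set \<open>K - U\<close>, hence at least some \<delta> > 0. So iterating
  \<open>T\<close> reaches \<open>U\<close> after finitely many steps, and \<open>pull\<close>
  carries \<open>P\<close> back along the orbit.\<close>

lemma compact_contraction_induct:
  fixes T :: "'a::metric_space \<Rightarrow> 'a"
  assumes "compact K" and "continuous_on K T" and "T \<in> K \<rightarrow> K"
    and closer: "\<And>x. x \<in> K \<Longrightarrow> x \<noteq> p \<Longrightarrow> dist (T x) p < dist x p"
    and "open U" and "p \<in> U"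
    and near: "\<And>x. x \<in> K \<inter> U \<Longrightarrow> P x"
    and pull: "\<And>x. x \<in> K \<Longrightarrow> P (T x) \<Longrightarrow> P x"
    and "x \<in> K"
  shows "P x"
proof -
  have "\<exists>\<delta>>0. \<forall>y\<in>K - U. \<delta> \<le> dist y p - dist (T y) p"
  proof (cases "K - U = {}")
    case True
    then show ?thesis by (auto intro: exI[of _ 1])
  next
    case False
    have "compact (K - U)" using assms by (simp add: compact_diff)
    moreover have "continuous_on (K - U) (\<lambda>y. dist y p - dist (T y) p)"
      by (intro continuous_intros continuous_on_subset[OF \<open>continuous_on K T\<close>]) auto
    ultimately obtain z where "z \<in> K - U"
      and "\<forall>y\<in>K - U. dist z p - dist (T z) p \<le> dist y p - dist (T y) p"
      using continuous_attains_inf[OF _ False] by blast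
    moreover from this have "0 < dist z p - dist (T z) p"
      using closer \<open>p \<in> U\<close> by force
    ultimately show ?thesis by blast
  qed
  then obtain \<delta> where "\<delta> > 0" and \<delta>: "\<And>y. y \<in> K - U \<Longrightarrow> \<delta> \<le> dist y p - dist (T y) p"
    by blast
  \<comment> \<open>\<open>n\<close> bounds the number of applications of \<open>T\<close>; for
    \<open>n = 0\<close> the bound forces \<open>y = p\<close>, a point of \<open>U\<close>.\<close>
  have step: "y \<in> K \<Longrightarrow> dist y p \<le> of_nat n * \<delta> \<Longrightarrow> P y" for n y
  proof (induction n arbitrary: y)
    case 0
    then show ?case using near \<open>p \<in> U\<close> by auto
  next
    case (Suc n)
    show ?case
    proof (cases "y \<in> U")
      case True
      then show ?thesis using near Suc.prems by blast
    next
      case False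
      then have "dist (T y) p \<le> of_nat n * \<delta>"
        using \<delta>[of y] Suc.prems by (simp add: algebra_simps)
      then show ?thesis using Suc.IH[of "T y"] Suc.prems(1) pull \<open>T \<in> K \<rightarrow> K\<close> by blast
    qed
  qed
  obtain n where "dist x p < of_nat n * \<delta>"
    using \<open>\<delta> > 0\<close> reals_Archimedean3 by blast
  then show ?thesis using step[of x n] \<open>x \<in> K\<close> by simp
qed

context
  fixes M :: "real \<Rightarrow> real \<Rightarrow> real \<Rightarrow> real"
  assumes M: "weighted_mean M"
begin

text \<open>Each tail drops the leading conjunct of the previous one, so that every axiom below is
  extracted from the head of a tail.\<close>

lemmas WM0_tail = M[unfolded weighted_mean_def]
lemmas WM1_tail = WM0_tail[THEN conjunct2]
lemmas WM2_tail = WM1_tail[THEN conjunct2]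
lemmas WM3_tail = WM2_tail[THEN conjunct2]
lemmas WM4_tail = WM3_tail[THEN conjunct2]
lemmas WM5_tail = WM4_tail[THEN conjunct2]
lemmas WM6_tail = WM5_tail[THEN conjunct2]
lemmas WM7_tail = WM6_tail[THEN conjunct2]
lemmas WM8 = WM7_tail[THEN conjunct2]

lemma mean_pos: "u > 0 \<Longrightarrow> v > 0 \<Longrightarrow> l \<in> {0..1} \<Longrightarrow> M u v l > 0"
  using WM0_tail[THEN conjunct1] by blast

lemma mean_swap: "u > 0 \<Longrightarrow> v > 0 \<Longrightarrow> l \<in> {0..1} \<Longrightarrow> M u v l = M v u (1 - l)"
  using WM1_tail[THEN conjunct1] by blast

lemma mean_idem: "u > 0 \<Longrightarrow> l \<in> {0..1} \<Longrightarrow> M u u l = u"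
  using WM2_tail[THEN conjunct1] by blast

lemma mean_between: "u > 0 \<Longrightarrow> v > 0 \<Longrightarrow> u < v \<Longrightarrow> l \<in> {0<..<1} \<Longrightarrow> u < M u v l \<and> M u v l < v"
  using WM3_tail[THEN conjunct1] by blast

lemma mean_scale: "u > 0 \<Longrightarrow> v > 0 \<Longrightarrow> l \<in> {0..1} \<Longrightarrow> c > 0 \<Longrightarrow> M (c * u) (c * v) l = c * M u v l"
  using WM4_tail[THEN conjunct1] by blast

lemma mean_mono1: "u > 0 \<Longrightarrow> v > 0 \<Longrightarrow> l \<in> {0..1} \<Longrightarrow> w > 0 \<Longrightarrow> u \<le> w \<Longrightarrow> M u v l \<le> M w v l"
  using WM5_tail[THEN conjunct1] by blast

lemma mean_mono2: "u > 0 \<Longrightarrow> v > 0 \<Longrightarrow> l \<in> {0..1} \<Longrightarrow> w > 0 \<Longrightarrow> v \<le> w \<Longrightarrow> M u v l \<le> M u w l"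
  using WM5_tail[THEN conjunct1] by blast

lemma mean_strict:
  "u > 0 \<Longrightarrow> v > 0 \<Longrightarrow> u \<noteq> v \<Longrightarrow> strict_mono_on {0..1} (M u v) \<or> strict_antimono_on {0..1} (M u v)"
  using WM6_tail[THEN conjunct1] by blast

lemma mean_continuous: "u > 0 \<Longrightarrow> v > 0 \<Longrightarrow> u \<noteq> v \<Longrightarrow> continuous_on {0..1} (M u v)"
  using WM6_tail[THEN conjunct1] by blast

lemma mean_bisym:
  "u > 0 \<Longrightarrow> v > 0 \<Longrightarrow> z > 0 \<Longrightarrow> w > 0 \<Longrightarrow> s \<in> {0..1} \<Longrightarrow> l \<in> {0..1} \<Longrightarrow>
    M (M u v l) (M z w l) s = M (M u z s) (M v w s) l"
  using WM7_tail[THEN conjunct1] by blast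

lemma mean_affine:
  "u > 0 \<Longrightarrow> v > 0 \<Longrightarrow> s \<in> {0..1} \<Longrightarrow> l \<in> {0..1} \<Longrightarrow> k \<in> {0..1} \<Longrightarrow>
    M u v (s * l + (1 - s) * k) = M (M u v l) (M u v k) s"
  using WM8 by blast

lemma mean_strictly_between:
  assumes "u > 0" and "v > 0" and "u \<noteq> v" and "l \<in> {0<..<1}"
  shows "M u v l \<in> {min u v<..<max u v}"
proof (cases "u < v")
  case True
  then show ?thesis using mean_between assms by simp
next
  case False
  then show ?thesis using mean_between[of v u "1 - l"] mean_swap[of u v l] assms by simp
qed

text \<open>Intermediate value theorem. The bounds use \<open>min\<close> and \<open>max\<close>
  because at this stage neither the values at the weights 0 and 1 nor their order is known.\<close>

lemma mean_range:
  assumes "u > 0" and "v > 0" and "u \<noteq> v"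
    and "min (M u v 0) (M u v 1) \<le> x" and "x \<le> max (M u v 0) (M u v 1)"
  obtains l where "l \<in> {0..1}" and "x = M u v l"
proof -
  have c: "connected (M u v ` {0..1})"
    using mean_continuous assms by (intro connected_continuous_image) auto
  have m: "M u v 0 \<in> M u v ` {0..1}" "M u v 1 \<in> M u v ` {0..1}" by auto
  have "x \<in> M u v ` {0..1}"
    using connectedD_interval[OF c m] connectedD_interval[OF c m(2) m(1)] assms(4,5)
    by (cases "M u v 0 \<le> M u v 1") (auto simp only: min_def max_def if_True if_False linorder_not_le less_imp_le)
  then show ?thesis using that by blast
qed

text \<open>By homogeneity, monotonicity in the first argument makes \<open>M u x l / x\<close> antitone in \<open>x\<close>.\<close>

lemma continuous_on_mean2:
  assumes "u > 0" and "l \<in> {0..1}"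
  shows "continuous_on {0<..} (\<lambda>x. M u x l)"
proof -
  have upper: "M u y l \<le> (y / x) * M u x l" if "0 < x" "x \<le> y" for x y
  proof -
    have "M u y l \<le> M ((y / x) * u) ((y / x) * x) l"
      using that assms mean_mono1[of u y l "y / x * u"] by (simp add: field_simps)
    then show ?thesis using mean_scale[of u x l "y / x"] that assms by simp
  qed
  \<comment> \<open>The quotient \<open>M u x l / x\<close> bounds the slope to the right of
    \<open>x\<close> and is antitone, so its value at \<open>m\<close> is a Lipschitz constant
    beyond \<open>m\<close>. These open half-lines cover the positive reals.\<close>
  have "continuous_on {m<..} (\<lambda>x. M u x l)" if "m > 0" for m
  proof -
    have le: "\<bar>M u y l - M u x l\<bar> \<le> (M u m l / m) * \<bar>y - x\<bar>" if "m < x" "x \<le> y" for x y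
    proof -
      have "M u y l - M u x l \<le> (M u x l / x) * (y - x)"
        using upper[of x y] that \<open>m > 0\<close> by (simp add: field_simps)
      also have "\<dots> \<le> (M u m l / m) * (y - x)"
        using upper[of m x] that \<open>m > 0\<close> by (intro mult_right_mono) (auto simp: field_simps)
      finally show ?thesis using mean_mono2[of u x l y] that \<open>m > 0\<close> assms by simp
    qed
    have "(M u m l / m)-lipschitz_on {m<..} (\<lambda>x. M u x l)"
    proof (rule lipschitz_onI)
      show "0 \<le> M u m l / m" using mean_pos[of u m l] that assms by simp
    next
      fix x y assume "x \<in> {m<..}" "y \<in> {m<..}"
      then show "dist (M u x l) (M u y l) \<le> M u m l / m * dist x y"
        using le[of x y] le[of y x] by (cases "x \<le> y") (auto simp: dist_real_def abs_minus_commute)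
    qed
    then show ?thesis by (rule lipschitz_on_continuous_on)
  qed
  then have "continuous_on (\<Union>m\<in>{0<..}. {m<..}) (\<lambda>x. M u x l)"
    by (intro continuous_on_open_UN) auto
  moreover have "(\<Union>m\<in>{0<..}. {m<..}) = {0::real<..}"
    using dense by fastforce
  ultimately show ?thesis by simp
qed

text \<open>The two inequalities confine \<open>p / q\<close> strictly between \<open>a / b\<close>
  and \<open>b / a\<close>, which lets one factor scale both points into \<open>{a..b}\<close>.
  Written without division, they visibly define an open condition on \<open>q\<close>.\<close>

lemma mean_one_near:
  obtains a b where "0 < a" and "a < b"
    and "\<And>p q. 0 < p \<Longrightarrow> 0 < q \<Longrightarrow> a * p < b * q \<Longrightarrow> a * q < b * p \<Longrightarrow> M p q 1 = p"
proof -
  define a b where "a = min (M 1 2 0) (M 1 2 1)" and "b = max (M 1 2 0) (M 1 2 1)"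
  have "M 1 2 0 \<noteq> M 1 2 1"
    using mean_strict[of 1 2] monotone_onD[of "{0..1}" "(<)" "(<)" "M 1 2" 0 1]
      monotone_onD[of "{0..1}" "(<)" "(>)" "M 1 2" 0 1] by auto
  then have "a < b" unfolding a_def b_def by auto
  moreover have "0 < a" unfolding a_def using mean_pos by simp
  moreover have "M p q 1 = p" if pq: "0 < p" "0 < q" "a * p < b * q" "a * q < b * p" for p q
  proof -
    have *: "M x y 1 = x" if xy: "x \<in> {a..b}" "y \<in> {a..b}" for x y
    proof -
      obtain l where "l \<in> {0..1}" "x = M 1 2 l"
        by (rule mean_range[of 1 2 x]) (use xy in \<open>auto simp: a_def b_def\<close>)
      moreover obtain k where "k \<in> {0..1}" "y = M 1 2 k"
        by (rule mean_range[of 1 2 y]) (use xy in \<open>auto simp: a_def b_def\<close>)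
      \<comment> \<open>At \<open>s = 1\<close> the weight \<open>s * l + (1 - s) * k\<close>
        collapses to \<open>l\<close>.\<close>
      ultimately show ?thesis using mean_affine[of 1 2 1 l k] by simp
    qed
    \<comment> \<open>The factor sends \<open>p\<close> to the endpoint \<open>a\<close> if
      \<open>p \<le> q\<close> and to \<open>b\<close> otherwise, so that \<open>q\<close> lands on
      the inner side of that endpoint.\<close>
    define c where "c = (if p \<le> q then a else b) / p"
    have "c > 0" using pq \<open>0 < a\<close> \<open>a < b\<close> by (simp add: c_def)
    have "c * p \<in> {a..b}" "c * q \<in> {a..b}"
      using pq \<open>0 < a\<close> \<open>a < b\<close> by (auto simp: c_def field_simps)
    then show ?thesis using *[of "c * p" "c * q"] mean_scale[of p q 1 c] pq \<open>c > 0\<close> by simp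
  qed
  ultimately show ?thesis using that by blast
qed

lemma mean_one:
  assumes p: "p > 0" and q: "q > 0"
  shows "M p q 1 = p"
proof -
  obtain a b where ab: "0 < a" "a < b"
    and near: "\<And>p q. 0 < p \<Longrightarrow> 0 < q \<Longrightarrow> a * p < b * q \<Longrightarrow> a * q < b * p \<Longrightarrow> M p q 1 = p"
    using mean_one_near by blast
  define T where "T x = M p x (1/2)" for x
  define K where "K = {min p q..max p q}"
  have K_pos: "x > 0" if "x \<in> K" for x using that p q unfolding K_def by auto
  have T_between: "T x \<in> {min p x<..<max p x}" if "x \<in> K" "x \<noteq> p" for x
    using mean_strictly_between[of p x "1/2"] that p K_pos unfolding T_def by simp
  have T_self: "T p = p" using mean_idem p unfolding T_def by simp
  \<comment> \<open>A substitute for injectivity of \<open>T\<close>: the value \<open>p\<close> is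
    attained only at \<open>p\<close>.\<close>
  have Tp: "T x \<noteq> p" if "x > 0" "x \<noteq> p" for x
    using mean_strictly_between[of p x "1/2"] that p unfolding T_def by (auto simp: min_def max_def split: if_splits)
  show ?thesis
  proof (rule compact_contraction_induct[where K = K and T = T and p = p and P = "\<lambda>x. M p x 1 = p"
        and U = "{x. a * p < b * x} \<inter> {x. a * x < b * p}"])
    show "compact K" "q \<in> K" unfolding K_def by auto
    show "continuous_on K T" unfolding T_def
      using continuous_on_subset[OF continuous_on_mean2[of p "1/2"], of K] p K_pos by fastforce
    show "T \<in> K \<rightarrow> K"
    proof
      fix x assume "x \<in> K"
      then show "T x \<in> K"
        using T_between[of x] T_self unfolding K_def by (cases "x = p") auto
    qed
    show "dist (T x) p < dist x p" if "x \<in> K" "x \<noteq> p" for x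
      using T_between[OF that] by (auto simp: dist_real_def min_def max_def split: if_splits)
    show "open ({x. a * p < b * x} \<inter> {x. a * x < b * p})"
      by (intro open_Int open_Collect_less continuous_intros)
    show "p \<in> {x. a * p < b * x} \<inter> {x. a * x < b * p}" using ab p by simp
    show "M p x 1 = p" if "x \<in> K \<inter> ({x. a * p < b * x} \<inter> {x. a * x < b * p})" for x
      using near[of p x] that p K_pos by auto
    \<comment> \<open>Bisymmetry with \<open>p\<close> in three slots turns the hypothesis into
      \<open>T (M p x 1) = p\<close>, and \<open>Tp\<close> then identifies
      \<open>M p x 1\<close>.\<close>
    show "M p x 1 = p" if "x \<in> K" "M p (T x) 1 = p" for x
    proof -
      have "T (M p x 1) = M p (T x) 1"
        using mean_bisym[of p p p x "1/2" 1] mean_idem p K_pos[OF that(1)] unfolding T_def by simp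
      then show ?thesis using Tp[of "M p x 1"] that p K_pos mean_pos by fastforce
    qed
  qed
qed

lemma mean_zero: "u > 0 \<Longrightarrow> v > 0 \<Longrightarrow> M u v 0 = v"
  using mean_swap[of u v 0] mean_one[of v u] by simp

lemma mean_surj:
  assumes "u > 0" and "u \<le> v" and "x \<in> {u..v}"
  obtains l where "l \<in> {0..1}" and "x = M u v l"
proof (cases "u = v")
  case True
  then show ?thesis using that[of 1] mean_one[of u v] assms by simp
next
  case False
  then show ?thesis using that mean_range[of u v x] mean_one[of u v] mean_zero[of u v] assms by auto
qed

end

theorem theorem8:
  fixes M N :: "real \<Rightarrow> real \<Rightarrow> real \<Rightarrow> real"
    and u v :: real and J :: "real set" and f :: "real \<Rightarrow> real"
  assumes "weighted_mean M" and "weighted_mean N"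
    and "same_direction M N"
    and "0 < u" and "u \<le> v"
    and "is_interval J" and "J \<subseteq> {0<..}"
    and "f \<in> {u..v} \<rightarrow> J"
    and "MN_convex_on {u..v} M N f"
    and "mean_symmetric_on u v M f"
  shows "\<forall>x\<in>{u..v}. f (M u v (1/2)) \<le> f x \<and> f x \<le> N (f u) (f v) (1/2)"
proof
  fix x assume x: "x \<in> {u..v}"
  note M = \<open>weighted_mean M\<close> and N = \<open>weighted_mean N\<close>
  have "v > 0" using assms by simp
  obtain l where l: "l \<in> {0..1}" "x = M u v l"
    using mean_surj[OF M \<open>0 < u\<close> \<open>u \<le> v\<close> x] by blast
  have pos: "f y > 0" if "y \<in> {u..v}" for y using assms that by fastforce
  have conv: "f (M a b k) \<le> N (f a) (f b) k" if "a \<in> {u..v}" "b \<in> {u..v}" "k \<in> {0..1}" for a b k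
    using assms(9) that unfolding MN_convex_on_def by blast
  have sym: "f (M u v k) = f (M u v (1 - k))" if "k \<in> {0..1}" for k
    using assms(10) that unfolding mean_symmetric_on_def by blast
  \<comment> \<open>The weights 1 and 0 are exchanged by the symmetry and yield the endpoints
    \<open>u\<close> and \<open>v\<close>.\<close>
  have "f u = f v"
    using sym[of 1] mean_one[OF M \<open>0 < u\<close> \<open>v > 0\<close>] mean_zero[OF M \<open>0 < u\<close> \<open>v > 0\<close>] by simp
  then have N_const: "N (f u) (f v) k = f u" if "k \<in> {0..1}" for k
    using mean_idem[OF N, of "f u" k] pos[of u] that assms by simp
  \<comment> \<open>Since \<open>f u = f v\<close>, the convexity bound at weight \<open>l\<close>
    has the same value as at 1/2.\<close>
  have "f x \<le> N (f u) (f v) (1/2)"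
    using conv[of u v l] l N_const[of l] N_const[of "1/2"] assms by simp
  moreover have "f (M u v (1/2)) \<le> f x"
  proof -
    \<comment> \<open>\<open>y\<close> is the mirror image of \<open>x\<close>: \<open>f\<close>
      agrees at both, and their midpoint is that of \<open>u\<close> and \<open>v\<close>.\<close>
    define y where "y = M u v (1 - l)"
    have "y \<in> {u..v}"
    \<comment> \<open>Betweenness is an axiom only for interior weights and \<open>u < v\<close>;
      the boundary weights and \<open>u = v\<close> are treated separately.\<close>
    proof (cases "l \<in> {0<..<1} \<and> u < v")
      case True
      then show ?thesis using mean_between[OF M \<open>0 < u\<close> \<open>v > 0\<close>, of "1 - l"] by (simp add: y_def)
    next
      case False
      then consider "l = 0" | "l = 1" | "u = v" using l \<open>u \<le> v\<close> by fastforce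
      then show ?thesis
        using mean_one[OF M \<open>0 < u\<close> \<open>v > 0\<close>] mean_zero[OF M \<open>0 < u\<close> \<open>v > 0\<close>]
          mean_idem[OF M \<open>0 < u\<close>, of "1 - l"] l(1) \<open>u \<le> v\<close>
        by cases (auto simp: y_def)
    qed
    have "f y = f x" using sym[OF l(1)] l(2) by (simp add: y_def)
    have "M u v ((1/2) * l + (1 - 1/2) * (1 - l)) = M x y (1/2)"
      unfolding y_def l(2) using l(1) by (intro mean_affine[OF M \<open>0 < u\<close> \<open>v > 0\<close>]) auto
    moreover have "(1/2) * l + (1 - 1/2) * (1 - l) = 1/2" by (simp add: field_simps)
    ultimately have "M u v (1/2) = M x y (1/2)" by (simp only:)
    then show ?thesis
      using conv[OF x \<open>y \<in> {u..v}\<close>, of "1/2"] mean_idem[OF N pos[OF x], of "1/2"] \<open>f y = f x\<close> by simp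
  qed
  ultimately show "f (M u v (1/2)) \<le> f x \<and> f x \<le> N (f u) (f v) (1/2)" by blast
qed

end
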